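(* Let $A\in\mathbb{R}^{n\times n}$ be invertible, let $U,V\in\mathbb{R}^{n\times k}$ have full column rank, assume $I+V^TA^{-1}U$ is invertible, and let $B=A+UV^T$. Let $\widetilde{A}^{-1}\in\mathbb{R}^{n\times n}$ and $Z^{-1}\in\mathbb{R}^{k\times k}$ be approximate inverses with errors $\epsilon_1=\|\widetilde{A}^{-1}-A^{-1}\|_2$ and $\epsilon_2=\|Z^{-1}-(I+V^T\widetilde{A}^{-1}U)^{-1}\|_2$, where $I+V^T\widetilde{A}^{-1}U$ is invertible, and let $\lambda=\|U\|_2\|V\|_2$. Assume that: (i) $\|I+V^TA^{-1}U\|_2\le\beta$; (ii) the matrices $\widetilde{A}^{-1}$ and $Z^{-1}$ are invertible, and $(Z^{-1})^{-1}-V^T\widetilde{A}^{-1}U$ is invertible; (iii) $\epsilon_1<\dfrac{1}{2\|A\|_2}$; (iv) $\epsilon_2<\dfrac{1}{2(\beta+\lambda\epsilon_1)}$; (v) $2(\beta+\lambda\epsilon_1)^2\epsilon_2<\dfrac12$. Assume moreover that $\epsilon_1=\epsilon_2=\epsilon\le1$, $\sigma_{\min}(A)\le1$, and $\beta\ge\max\left(\lambda,\frac{\|A\|_2}{\sqrt{\lambda}},1\right)$. Then $$\left\|B-\left(\widetilde{A}^{-1}-\widetilde{A}^{-1}UZ^{-1}V^T\widetilde{A}^{-1}\right)^{-1}\right\|_2\le 18\,\lambda\,\epsilon\,\beta^2.$$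
   Context: $\|\cdot\|_2$ is the spectral norm, $\sigma_{\min}(A)$ is the smallest singular value of $A$, and $I$ is the identity matrix of appropriate size. $\widetilde{A}^{-1}$ is a single symbol for a given $n\times n$ matrix (the computed approximation of $A^{-1}$), and $Z^{-1}$ is a single symbol for a given $k\times k$ matrix (the computed approximation of $(I+V^T\widetilde{A}^{-1}U)^{-1}$); $(Z^{-1})^{-1}$ is the inverse of the latter matrix. *)

theory Defs
  imports "HOL-Analysis.Analysis"
begin

definition spectral_norm :: "real^'n^'m \<Rightarrow> real" where
  "spectral_norm A = onorm (\<lambda>x. A *v x)"

(* Non-negative square roots of the eigenvalues of A^T A.  As a set this forgets
   multiplicities; it is finite and non-empty because A^T A is symmetric positive
   semidefinite. *)
definition singular_values :: "real^'n^'n \<Rightarrow> real set" where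
  "singular_values A =
     {s. s \<ge> 0 \<and> (\<exists>x. x \<noteq> 0 \<and> (transpose A ** A) *v x = s\<^sup>2 *\<^sub>R x)}"

definition sigma_min :: "real^'n^'n \<Rightarrow> real" where
  "sigma_min A = Min (singular_values A)"

end

theory Submission imports Defs begin

text \<open>Write \<open>M\<close>, \<open>W\<close> for the approximate inverses \<open>Ainv\<close>, \<open>Zinv\<close>, and put
  \<open>S = I + V\<^sup>T M U\<close> and \<open>K = W\<^sup>-\<^sup>1 - V\<^sup>T M U = I + (W\<^sup>-\<^sup>1 - S)\<close>. By Woodbury's identity the error is
  \<open>(A - M\<^sup>-\<^sup>1) + U (I - K\<^sup>-\<^sup>1) V\<^sup>T\<close>. The estimate \<open>\<parallel>M\<^sup>-\<^sup>1 - X\<parallel> \<le> 2 \<parallel>X\<parallel>\<^sup>2 \<parallel>M - X\<^sup>-\<^sup>1\<parallel>\<close>,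
  valid when \<open>\<parallel>X\<parallel> \<parallel>M - X\<^sup>-\<^sup>1\<parallel> \<le> 1/2\<close>, is used three times, with the pairs \<open>(M, A)\<close>, \<open>(W, S)\<close> and \<open>(K, I)\<close>.
  The first summand contributes \<open>2 \<parallel>A\<parallel>\<^sup>2 \<epsilon> \<le> 2 \<lambda> \<epsilon> \<beta>\<^sup>2\<close>, the second one
  \<open>4 \<lambda> \<epsilon> (\<beta> + \<lambda> \<epsilon>)\<^sup>2 \<le> 16 \<lambda> \<epsilon> \<beta>\<^sup>2\<close>.\<close>

lemma matrix_add_rdistrib:
  fixes A B :: "'a::semiring_1^'n^'m" and C :: "'a^'k^'n"
  shows "(A + B) ** C = A ** C + B ** C"
  by (vector matrix_matrix_mult_def sum.distrib distrib_right)

lemma matrix_diff_rdistrib: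
  fixes A B :: "'a::ring_1^'n^'m" and C :: "'a^'k^'n"
  shows "(A - B) ** C = A ** C - B ** C"
  by (vector matrix_matrix_mult_def sum_subtractf left_diff_distrib)

lemma matrix_diff_ldistrib:
  fixes A :: "'a::ring_1^'n^'m" and B C :: "'a^'k^'n"
  shows "A ** (B - C) = A ** B - A ** C"
  by (vector matrix_matrix_mult_def sum_subtractf right_diff_distrib)

lemma matrix_inv_left_right:
  assumes "invertible A"
  shows "matrix_inv A ** A = mat 1" "A ** matrix_inv A = mat 1"
  using someI_ex[OF assms[unfolded invertible_def]] unfolding matrix_inv_def by auto

lemma matrix_inv_eqI:
  fixes A H :: "real^'n^'n"
  assumes "A ** H = mat 1"
  shows "invertible A" "matrix_inv A = H"
proof -
  show inv: "invertible A"
    using assms invertible_right_inverse by blast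
  have "matrix_inv A ** (A ** H) = H"
    by (simp only: matrix_mul_assoc matrix_inv_left_right[OF inv] matrix_mul_lid)
  then show "matrix_inv A = H"
    by (simp add: assms)
qed

lemma spectral_norm_nonneg: "0 \<le> spectral_norm A"
  unfolding spectral_norm_def by (simp add: onorm_pos_le)

lemma norm_mult_vec_le_spectral_norm: "norm (A *v x) \<le> spectral_norm A * norm x"
  unfolding spectral_norm_def by (simp add: onorm)

lemma spectral_norm_leI:
  assumes "\<And>x. norm (A *v x) \<le> b * norm x"
  shows "spectral_norm A \<le> b"
  unfolding spectral_norm_def using assms by (rule onorm_le)

lemma spectral_norm_pos:
  assumes "A \<noteq> 0"
  shows "0 < spectral_norm A"
proof (rule ccontr)
  assume "\<not> 0 < spectral_norm A"
  then have "spectral_norm A = 0"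
    using spectral_norm_nonneg[of A] by simp
  then have "A *v x = 0 *v x" for x
    using norm_mult_vec_le_spectral_norm[of A x] by simp
  then show False
    using assms by (simp add: matrix_eq)
qed

lemma spectral_norm_mult: "spectral_norm (A ** B) \<le> spectral_norm A * spectral_norm B"
proof (rule spectral_norm_leI)
  fix x
  have "norm (A *v (B *v x)) \<le> spectral_norm A * norm (B *v x)"
    by (rule norm_mult_vec_le_spectral_norm)
  also have "\<dots> \<le> spectral_norm A * (spectral_norm B * norm x)"
    by (intro mult_left_mono norm_mult_vec_le_spectral_norm spectral_norm_nonneg)
  finally show "norm ((A ** B) *v x) \<le> spectral_norm A * spectral_norm B * norm x"
    by (simp add: matrix_vector_mul_assoc mult.assoc)
qed

lemma spectral_norm_mult3:
  "spectral_norm (A ** B ** C) \<le> spectral_norm A * spectral_norm B * spectral_norm C"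
  by (rule order_trans[OF spectral_norm_mult])
     (intro mult_right_mono spectral_norm_mult spectral_norm_nonneg)

lemma spectral_norm_triangle: "spectral_norm (A + B) \<le> spectral_norm A + spectral_norm B"
  using onorm_triangle[of "(*v) A" "(*v) B"]
  unfolding spectral_norm_def by (simp add: matrix_vector_mult_add_rdistrib[abs_def])

lemma spectral_norm_minus_commute: "spectral_norm (A - B) = spectral_norm (B - A)"
  unfolding spectral_norm_def onorm_def
  by (simp add: matrix_vector_mult_diff_rdistrib norm_minus_commute)

lemma spectral_norm_mat_1_le: "spectral_norm (mat 1 :: real^'n^'n) \<le> 1"
  by (rule spectral_norm_leI) simp

text \<open>For \<open>y = transpose A *v x\<close>, moving the transpose across the inner product
  gives |y|^2 = <x, A y>, to which Cauchy-Schwarz applies; then one factor |y| cancels.\<close>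

lemma spectral_norm_transpose_le: "spectral_norm (transpose A) \<le> spectral_norm A"
proof (rule spectral_norm_leI)
  fix x
  let ?y = "transpose A *v x"
  have "norm ?y * norm ?y = inner ?y ?y"
    by (simp add: dot_square_norm power2_eq_square)
  also have "\<dots> = inner x (A *v ?y)"
    by (simp add: dot_lmul_matrix)
  also have "\<dots> \<le> norm x * norm (A *v ?y)"
    by (rule norm_cauchy_schwarz)
  also have "\<dots> \<le> norm x * (spectral_norm A * norm ?y)"
    by (intro mult_left_mono norm_mult_vec_le_spectral_norm) simp
  finally have "norm ?y * norm ?y \<le> (spectral_norm A * norm x) * norm ?y"
    by (simp add: ac_simps)
  then show "norm ?y \<le> spectral_norm A * norm x"
    by (cases "norm ?y = 0") (auto simp: spectral_norm_nonneg)
qed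

lemma spectral_norm_sandwich_le:
  fixes U :: "real^'k^'n" and V :: "real^'l^'m"
  shows "spectral_norm (U ** X ** transpose V) \<le> spectral_norm U * spectral_norm V * spectral_norm X"
proof -
  have "spectral_norm (U ** X ** transpose V) \<le> spectral_norm U * spectral_norm X * spectral_norm (transpose V)"
    by (rule spectral_norm_mult3)
  also have "\<dots> \<le> spectral_norm U * spectral_norm X * spectral_norm V"
    by (intro mult_left_mono spectral_norm_transpose_le mult_nonneg_nonneg spectral_norm_nonneg)
  finally show ?thesis
    by (simp add: ac_simps)
qed

text \<open>With N the inverse of \<open>M\<close>, the identity X - N = N (M - X^-1) X bounds d =
  |N - X| by |N| e x. No bound on |N| is assumed, so |N| is replaced by x + d. The smallness
  condition x e \<le> 1/2 then absorbs half of d into the left side, which is where the factor 2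
  comes from.\<close>

lemma inverse_perturbation_bound:
  fixes M X :: "real^'n^'n"
  assumes M: "invertible M" and X: "invertible X"
    and small: "spectral_norm X * spectral_norm (M - matrix_inv X) \<le> 1 / 2"
  shows "spectral_norm (matrix_inv M - X)
    \<le> 2 * (spectral_norm X)\<^sup>2 * spectral_norm (M - matrix_inv X)"
proof -
  let ?N = "matrix_inv M"
  define e x d where "e = spectral_norm (M - matrix_inv X)" and "x = spectral_norm X"
    and "d = spectral_norm (?N - X)"
  have nonneg: "0 \<le> e" "0 \<le> x" "0 \<le> d"
    by (simp_all add: e_def x_def d_def spectral_norm_nonneg)
  have "?N ** (M - matrix_inv X) ** X = ?N ** M ** X - ?N ** (matrix_inv X ** X)"
    by (simp add: matrix_diff_ldistrib matrix_diff_rdistrib matrix_mul_assoc)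
  also have "\<dots> = X - ?N"
    by (simp add: matrix_inv_left_right M X)
  finally have "X - ?N = ?N ** (M - matrix_inv X) ** X" ..
  then have "d \<le> spectral_norm ?N * e * x"
    unfolding d_def e_def x_def
    by (metis spectral_norm_minus_commute spectral_norm_mult3)
  also have "\<dots> \<le> (x + d) * e * x"
    using spectral_norm_triangle[of X "?N - X"] nonneg
    by (intro mult_right_mono) (simp_all add: d_def x_def)
  also have "\<dots> = x\<^sup>2 * e + d * (x * e)"
    by (simp add: power2_eq_square algebra_simps)
  also have "\<dots> \<le> x\<^sup>2 * e + d * (1 / 2)"
    using small nonneg by (intro add_left_mono mult_left_mono) (simp_all add: e_def x_def)
  finally show ?thesis
    by (simp add: d_def e_def x_def)
qed

text \<open>It suffices to check that the proposed inverse is a right inverse, since the matrices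
  are square. Multiplying out leaves two correction terms, which cancel because W (W^-1 - P) Y = W
  reads Y - W P Y = W.\<close>

lemma woodbury_inverse:
  fixes M :: "real^'n^'n" and U V :: "real^'k^'n" and W :: "real^'k^'k"
  assumes M: "invertible M" and W: "invertible W"
    and K: "invertible (matrix_inv W - transpose V ** M ** U)"
  shows "invertible (M - M ** U ** W ** transpose V ** M)"
    and "matrix_inv (M - M ** U ** W ** transpose V ** M) =
      matrix_inv M + U ** matrix_inv (matrix_inv W - transpose V ** M ** U) ** transpose V"
proof -
  define P where "P = transpose V ** M ** U"
  define Y where "Y = matrix_inv (matrix_inv W - P)"
  have "W ** ((matrix_inv W - P) ** Y) = W"
    using K by (simp add: Y_def P_def matrix_inv_left_right)
  then have Y: "Y - W ** P ** Y = W"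
    by (simp add: matrix_diff_ldistrib matrix_diff_rdistrib matrix_mul_assoc
        matrix_inv_left_right W)
  let ?G = "M - M ** U ** W ** transpose V ** M"
  have MM: "C ** M ** matrix_inv M = C" for C :: "real^'n^'l"
    by (simp add: matrix_mul_assoc[symmetric] matrix_inv_left_right M)
  have "?G ** (matrix_inv M + U ** Y ** transpose V)
      = mat 1 - M ** U ** W ** transpose V + M ** U ** (Y - W ** P ** Y) ** transpose V"
    by (simp add: P_def MM matrix_inv_left_right M matrix_add_ldistrib matrix_diff_ldistrib
        matrix_diff_rdistrib matrix_mul_assoc)
  also have "\<dots> = mat 1"
    by (simp add: Y)
  finally have inv: "?G ** (matrix_inv M + U ** Y ** transpose V) = mat 1" .
  show "invertible ?G"
    "matrix_inv ?G = matrix_inv M + U ** matrix_inv (matrix_inv W - transpose V ** M ** U) ** transpose V"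
    using matrix_inv_eqI[OF inv] by (simp_all add: Y_def P_def)
qed

theorem mainTheorem6:
  fixes A B Ainv :: "real^'n^'n"
    and U V :: "real^'k^'n"
    and Zinv :: "real^'k^'k"
    and \<beta> \<epsilon> \<epsilon>1 \<epsilon>2 lam :: real
  assumes "invertible A"
    and "rank U = CARD('k)" and "rank V = CARD('k)"
    and "invertible (mat 1 + transpose V ** matrix_inv A ** U)"
    and "B = A + U ** transpose V"
    and "invertible (mat 1 + transpose V ** Ainv ** U)"
    and "\<epsilon>1 = spectral_norm (Ainv - matrix_inv A)"
    and "\<epsilon>2 = spectral_norm (Zinv - matrix_inv (mat 1 + transpose V ** Ainv ** U))"
    and "lam = spectral_norm U * spectral_norm V"
    and "spectral_norm (mat 1 + transpose V ** matrix_inv A ** U) \<le> \<beta>"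
    and "invertible Ainv" and "invertible Zinv"
    and "invertible (matrix_inv Zinv - transpose V ** Ainv ** U)"
    and "\<epsilon>1 < 1 / (2 * spectral_norm A)"
    and "\<epsilon>2 < 1 / (2 * (\<beta> + lam * \<epsilon>1))"
    and "2 * (\<beta> + lam * \<epsilon>1)\<^sup>2 * \<epsilon>2 < 1 / 2"
    and "\<epsilon>1 = \<epsilon>" and "\<epsilon>2 = \<epsilon>" and "\<epsilon> \<le> 1"
    and "sigma_min A \<le> 1"
    and "\<beta> \<ge> Max {lam, spectral_norm A / sqrt lam, 1}"
  shows "invertible (Ainv - Ainv ** U ** Zinv ** transpose V ** Ainv) \<and>
    spectral_norm (B - matrix_inv (Ainv - Ainv ** U ** Zinv ** transpose V ** Ainv))
      \<le> 18 * lam * \<epsilon> * \<beta>\<^sup>2"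
proof
  define S where "S = mat 1 + transpose V ** Ainv ** U"
  define K where "K = matrix_inv Zinv - transpose V ** Ainv ** U"
  define C where "C = matrix_inv K"
  define a where "a = spectral_norm A"
  define b where "b = \<beta> + lam * \<epsilon>"
  have invS: "invertible S" and invK: "invertible K"
    using assms by (simp_all add: S_def K_def)
  have e1: "\<epsilon> = spectral_norm (Ainv - matrix_inv A)"
    and e2: "\<epsilon> = spectral_norm (Zinv - matrix_inv S)"
    using assms by (simp_all add: S_def)
  have e0: "0 \<le> \<epsilon>"
    by (simp add: e1 spectral_norm_nonneg)
  \<comment> \<open>Full column rank is positive rank, so \<open>lam\<close> is positive and the
    bound on \<open>a / sqrt lam\<close> can be cleared of its denominator.\<close>
  have "U \<noteq> 0" "V \<noteq> 0"
    using assms(2,3) by (auto simp: rank_eq_0[symmetric])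
  then have lam0: "0 < lam"
    using assms(9) by (simp add: spectral_norm_pos)
  have beta: "lam \<le> \<beta>" "a / sqrt lam \<le> \<beta>" "1 \<le> \<beta>"
    using assms(21) by (simp_all add: a_def)
  have a0: "0 \<le> a"
    by (simp add: a_def spectral_norm_nonneg)
  \<comment> \<open>Squaring this turns the factor |A|^2 of the perturbation bound into \<beta>^2
    \<open>lam\<close>, the shape of the final estimate.\<close>
  have "a \<le> \<beta> * sqrt lam"
    using beta(2) lam0 by (simp add: divide_le_eq)
  then have "a\<^sup>2 \<le> (\<beta> * sqrt lam)\<^sup>2"
    using a0 by (rule power_mono)
  then have a_sq: "a\<^sup>2 \<le> \<beta>\<^sup>2 * lam"
    using lam0 by (simp add: power_mult_distrib)
  have "A \<noteq> 0"
  proof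
    assume "A = 0"
    then have "(mat 1 :: real^'n^'n) = 0"
      using matrix_inv_left_right(2)[OF assms(1)] by simp
    then have "(mat 1 :: real^'n^'n) *v 1 = (0 :: real^'n^'n) *v 1"
      by (simp only:)
    then show False
      by simp
  qed
  then have "0 < a"
    by (simp add: a_def spectral_norm_pos)
  then have "a * \<epsilon> \<le> 1 / 2"
    using assms(14,17) by (simp add: a_def field_simps)
  then have "spectral_norm (matrix_inv Ainv - A) \<le> 2 * a\<^sup>2 * \<epsilon>"
    unfolding a_def e1 by (rule inverse_perturbation_bound[OF assms(11,1)])
  also have "\<dots> \<le> 2 * (\<beta>\<^sup>2 * lam) * \<epsilon>"
    using a_sq e0 by (intro mult_right_mono) simp_all
  finally have A_bound: "spectral_norm (A - matrix_inv Ainv) \<le> 2 * (\<beta>\<^sup>2 * lam) * \<epsilon>"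
    by (simp add: spectral_norm_minus_commute)

  \<comment> \<open>As \<epsilon> \<le> 1 and \<open>lam\<close> \<le> \<beta>, the quantity
    \<open>b\<close> is at most 2 \<beta>; its square later turns the constant 4 into 16.\<close>
  have "lam * \<epsilon> \<le> lam" "0 \<le> lam * \<epsilon>"
    using lam0 e0 assms(19) by (simp_all add: mult_left_le)
  then have b: "0 < b" "b \<le> 2 * \<beta>"
    using beta unfolding b_def by linarith+
  \<comment> \<open>Replacing A^-1 by \<open>Ainv\<close> changes the capacitance matrix by a term
    of norm at most \<open>lam\<close> \<epsilon>, so \<open>b\<close> bounds the norm of
    \<open>S\<close>.\<close>
  have S_split: "S = (mat 1 + transpose V ** matrix_inv A ** U)
      + transpose V ** (Ainv - matrix_inv A) ** U"
    by (simp add: S_def matrix_diff_ldistrib matrix_diff_rdistrib)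
  have "spectral_norm (transpose V ** (Ainv - matrix_inv A) ** U)
      \<le> spectral_norm (transpose V) * \<epsilon> * spectral_norm U"
    unfolding e1 by (rule spectral_norm_mult3)
  also have "\<dots> \<le> spectral_norm V * \<epsilon> * spectral_norm U"
    by (intro mult_right_mono spectral_norm_transpose_le spectral_norm_nonneg e0)
  finally have "spectral_norm (transpose V ** (Ainv - matrix_inv A) ** U) \<le> lam * \<epsilon>"
    by (simp add: assms(9) ac_simps)
  then have S_b: "spectral_norm S \<le> b"
    using assms(10) spectral_norm_triangle unfolding S_split b_def by (meson add_mono order_trans)
  \<comment> \<open>The first bound admits the pair (\<open>Zinv\<close>, \<open>S\<close>) to the
    perturbation lemma, the second the pair (\<open>K\<close>, I).\<close>
  have b_e: "b * \<epsilon> \<le> 1 / 2" "2 * b\<^sup>2 * \<epsilon> \<le> 1 / 2"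
    using assms(15-18) b(1) by (simp_all add: b_def field_simps)
  have "spectral_norm S * \<epsilon> \<le> 1 / 2"
    using mult_right_mono[OF S_b e0] b_e(1) by linarith
  then have "spectral_norm (matrix_inv Zinv - S) \<le> 2 * (spectral_norm S)\<^sup>2 * \<epsilon>"
    unfolding e2 by (rule inverse_perturbation_bound[OF assms(12) invS])
  also have "\<dots> \<le> 2 * b\<^sup>2 * \<epsilon>"
    using S_b e0 by (intro mult_right_mono mult_left_mono power_mono spectral_norm_nonneg) simp_all
  finally have D: "spectral_norm (matrix_inv Zinv - S) \<le> 2 * b\<^sup>2 * \<epsilon>" .
  have inv_1: "matrix_inv (mat 1 :: real^'k^'k) = mat 1"
    by (rule matrix_inv_eqI) simp
  \<comment> \<open>The terms in \<open>Ainv\<close> agree, so \<open>D\<close> also measures the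
    distance of \<open>K\<close> from I. The inverse of I is kept to match the form of the
    perturbation lemma.\<close>
  have K_1: "K - matrix_inv (mat 1) = matrix_inv Zinv - S"
    by (simp add: K_def S_def inv_1)
  have "spectral_norm (mat 1 :: real^'k^'k) * spectral_norm (K - matrix_inv (mat 1)) \<le> 1 * (1 / 2)"
    unfolding K_1 using D b_e(2) by (intro mult_mono spectral_norm_mat_1_le spectral_norm_nonneg) simp_all
  then have "spectral_norm (C - mat 1)
      \<le> 2 * (spectral_norm (mat 1 :: real^'k^'k))\<^sup>2 * spectral_norm (K - matrix_inv (mat 1))"
    unfolding C_def
    by (intro inverse_perturbation_bound invK matrix_inv_eqI(1)[of "mat 1" "mat 1"]) simp_all
  also have "\<dots> \<le> 2 * 1\<^sup>2 * (2 * b\<^sup>2 * \<epsilon>)"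
    unfolding K_1 using D
    by (intro mult_mono power_mono spectral_norm_mat_1_le spectral_norm_nonneg) simp_all
  also have "\<dots> \<le> 4 * (2 * \<beta>)\<^sup>2 * \<epsilon>"
    using mult_right_mono[OF power_mono[OF b(2), of 2] e0] b(1) by (simp add: mult.commute)
  finally have C_bound: "spectral_norm (mat 1 - C) \<le> 16 * \<beta>\<^sup>2 * \<epsilon>"
    by (simp add: spectral_norm_minus_commute power_mult_distrib)

  let ?G = "Ainv - Ainv ** U ** Zinv ** transpose V ** Ainv"
  show "invertible ?G"
    by (rule woodbury_inverse) fact+
  have "matrix_inv ?G = matrix_inv Ainv + U ** C ** transpose V"
    unfolding C_def K_def by (rule woodbury_inverse) fact+
  \<comment> \<open>The low-rank part of \<open>B\<close> merges with the Woodbury correction, so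
    only the deviation of \<open>C\<close> from I remains between \<open>U\<close> and the transpose
    of \<open>V\<close>.\<close>
  then have "B - matrix_inv ?G = (A - matrix_inv Ainv) + U ** (mat 1 - C) ** transpose V"
    by (simp add: assms(5) matrix_diff_ldistrib matrix_diff_rdistrib)
  then have "spectral_norm (B - matrix_inv ?G)
      \<le> spectral_norm (A - matrix_inv Ainv) + spectral_norm (U ** (mat 1 - C) ** transpose V)"
    by (simp add: spectral_norm_triangle)
  also have "\<dots> \<le> 2 * (\<beta>\<^sup>2 * lam) * \<epsilon> + lam * spectral_norm (mat 1 - C)"
    unfolding assms(9) by (intro add_mono spectral_norm_sandwich_le A_bound[unfolded assms(9)])
  also have "\<dots> \<le> 2 * (\<beta>\<^sup>2 * lam) * \<epsilon> + lam * (16 * \<beta>\<^sup>2 * \<epsilon>)"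
    using C_bound lam0 by (intro add_left_mono mult_left_mono) simp_all
  finally show "spectral_norm (B - matrix_inv ?G) \<le> 18 * lam * \<epsilon> * \<beta>\<^sup>2"
    by (simp add: algebra_simps)
qed

end
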